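(* Let $A$ be a quasitriangular quasi-Hopf algebra over a field $K$ with R-matrix $R=\sum_l s_l\otimes t_l$, antipode $S$ and Drinfel'd element $u$. Let $$\tilde u := \sum_{i,l}\bar Z_i\, s_l\,\beta\, S(t_l)\, S\bigl(S(\bar X_i)\,\alpha\,\bar Y_i\bigr)$$ be the Drinfel'd element of the opposite and coopposite quasi-Hopf algebra $A^{\mathrm{op}\,\mathrm{cop}}$. Then $u = S(\tilde u)$.
   Context: All tensor products are over a fixed field $K$. A quasi-bialgebra $(A,\Delta,\varepsilon,\Phi)$ is an associative unital $K$-algebra $A$ with algebra homomorphisms $\Delta: A \to A\otimes A$ and $\varepsilon: A \to K$ and an invertible element $\Phi \in A\otimes A\otimes A$ such that, for all $a \in A$: (1) $(\mathrm{id}\otimes\Delta)\Delta(a)\,\Phi = \Phi\,(\Delta\otimes\mathrm{id})\Delta(a)$; (2) $(\mathrm{id}\otimes\mathrm{id}\otimes\Delta)(\Phi)(\Delta\otimes\mathrm{id}\otimes\mathrm{id})(\Phi) = (1\otimes\Phi)(\mathrm{id}\otimes\Delta\otimes\mathrm{id})(\Phi)(\Phi\otimes 1)$; (3) $(\varepsilon\otimes\mathrm{id})\Delta(a) = a = (\mathrm{id}\otimes\varepsilon)\Delta(a)$; (4) $(\mathrm{id}\otimes\varepsilon\otimes\mathrm{id})(\Phi) = 1\otimes 1$. Notation: $\Delta(a) = a_{(1)}\otimes a_{(2)}$, $\Delta^{\mathrm{cop}}(a) = a_{(2)}\otimes a_{(1)}$, $\Phi = \sum_i X_i\otimes Y_i\otimes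 Z_i$, $\Phi^{-1} = \sum_j \bar X_j\otimes\bar Y_j\otimes\bar Z_j$. A quasi-Hopf algebra is a quasi-bialgebra with an algebra anti-automorphism $S: A\to A$ (the antipode, in particular bijective) and elements $\alpha,\beta\in A$ such that, for all $a\in A$, $S(a_{(1)})\alpha a_{(2)} = \varepsilon(a)\alpha$, $a_{(1)}\beta S(a_{(2)}) = \varepsilon(a)\beta$, and $\sum_i X_i\beta S(Y_i)\alpha Z_i = 1 = \sum_j S(\bar X_j)\alpha\bar Y_j\beta S(\bar Z_j)$. A quasi-Hopf algebra is quasitriangular if it is endowed with an R-matrix, i.e. an invertible element $R = \sum_l s_l\otimes t_l\in A\otimes A$ such that (1) $\Delta^{\mathrm{cop}}(a)R = R\Delta(a)$ for all $a\in A$; (2) $(\Delta\otimes\mathrm{id})(R) = \sum_{i,j,k,l,q} Y_i s_l\bar X_j X_k\otimes Z_i\bar Z_j s_q Y_k\otimes X_i t_l\bar Y_j t_q Z_k$; (3) $(\mathrm{id}\otimes\Delta)(R) = \sum_{i,j,k,l,q}\bar Z_i s_l Y_j s_q\bar X_k\otimes\bar X_i X_j t_q\bar Y_k\otimes\bar Y_i t_l Z_j\bar Z_k$. The Drinfel'd element is $u := \sum_{i,l} S(\bar Y_i\beta S(\bar Z_i))\,S(t_l)\,\alpha\, s_l\,\bar X_i$. $A^{\mathrm{op}\,\mathrm{cop}}$ is the quasitriangular quasi-Hopf algebra with the opposite product and coopposite coproduct of $A$, the same counit and antipode, associator $\sum_i Z_i\otimes Y_i\otimes X_i$, evaluation element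 $\beta$ (in the role of $\alpha$), coevaluation element $\alpha$ (in the role of $\beta$), and the same R-matrix $R$; the displayed formula for $\tilde u$, with products taken in $A$, is its Drinfel'd element. *)

theory Defs
  imports Complex_Main "HOL-Library.Poly_Mapping"
begin

section \<open>Tensor powers of an algebra\<close>

definition free_scale :: "'k::field \<Rightarrow> ('i \<Rightarrow>\<^sub>0 'k) \<Rightarrow> ('i \<Rightarrow>\<^sub>0 'k)" where
  "free_scale c = Poly_Mapping.map ((*) c)"

lemma lookup_free_scale [simp]:
  "Poly_Mapping.lookup (free_scale c f) i = c * Poly_Mapping.lookup f i"
  by (simp add: free_scale_def map.rep_eq when_def)

global_interpretation free: vector_space free_scale
  by unfold_locales (auto intro!: poly_mapping_eqI simp: lookup_add algebra_simps)

text \<open>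
  The \<open>n\<close>-th tensor power of a vector space is the free vector space on the set of \<open>n\<close>-tuples,
  modulo the span of the relations that express linearity in each place. A place, with
  the other entries held fixed, is given by the map that inserts a vector there.
\<close>

definition places2 :: "('a \<Rightarrow> 'a \<times> 'a) set" where
  "places2 = {\<lambda>x. (x, y) |y. True} \<union> {\<lambda>y. (x, y) |x. True}"

definition places3 :: "('a \<Rightarrow> 'a \<times> 'a \<times> 'a) set" where
  "places3 = {\<lambda>x. (x, y, z) |y z. True} \<union> {\<lambda>y. (x, y, z) |x z. True}
     \<union> {\<lambda>z. (x, y, z) |x y. True}"

definition places4 :: "('a \<Rightarrow> 'a \<times> 'a \<times> 'a \<times> 'a) set" where
  "places4 = {\<lambda>x. (x, y, z, w) |y z w. True} \<union> {\<lambda>y. (x, y, z, w) |x z w. True}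
     \<union> {\<lambda>z. (x, y, z, w) |x y w. True} \<union> {\<lambda>w. (x, y, z, w) |x y z. True}"

lemma places_cover:
  "\<exists>g\<in>places2. p \<in> range g" "\<exists>g\<in>places3. q \<in> range g" "\<exists>g\<in>places4. r \<in> range g"
proof -
  show "\<exists>g\<in>places2. p \<in> range g"
    by (cases p) (auto simp: places2_def intro!: bexI[of _ "\<lambda>x. (x, snd p)"])
  show "\<exists>g\<in>places3. q \<in> range g"
    by (cases q) (auto simp: places3_def intro!: bexI[of _ "\<lambda>x. (x, fst (snd q), snd (snd q))"])
  show "\<exists>g\<in>places4. r \<in> range g"
    by (cases r) (auto simp: places4_def
      intro!: bexI[of _ "\<lambda>x. (x, fst (snd r), fst (snd (snd r)), snd (snd (snd r)))"])
qed

text \<open>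
  The type class \<open>ring_1\<close> excludes only the zero algebra, on which there is no counit
  because a counit maps \<open>1\<close> to \<open>1\<close>.
\<close>

locale unital_algebra = vector_space scale
  for scale :: "'k::field \<Rightarrow> 'a::ring_1 \<Rightarrow> 'a" (infixr \<open>*s\<close> 75) +
  assumes scale_mult_left: "(c *s x) * y = c *s (x * y)"
    and scale_mult_right: "x * (c *s y) = c *s (x * y)"
begin

definition tensor_relations :: "('a \<Rightarrow> 'i) set \<Rightarrow> ('i \<Rightarrow>\<^sub>0 'k) set" where
  "tensor_relations G =
     {Poly_Mapping.single (g (x + y)) 1 - Poly_Mapping.single (g x) 1 - Poly_Mapping.single (g y) 1
       |g x y. g \<in> G} \<union>
     {Poly_Mapping.single (g (c *s x)) 1 - free_scale c (Poly_Mapping.single (g x) 1)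
       |g c x. g \<in> G}"

definition tensor_class :: "('a \<Rightarrow> 'i) set \<Rightarrow> ('i \<Rightarrow>\<^sub>0 'k) \<Rightarrow> ('i \<Rightarrow>\<^sub>0 'k) set" where
  "tensor_class G f = {h. h - f \<in> free.span (tensor_relations G)}"

definition tensor_space :: "('a \<Rightarrow> 'i) set \<Rightarrow> ('i \<Rightarrow>\<^sub>0 'k) set set" where
  "tensor_space G = range (tensor_class G)"

text \<open>
  The tensor \<open>tensor G xs\<close> is the sum of the pure tensors given by the tuples in the list \<open>xs\<close>;
  conversely, \<open>terms G X\<close> is some way of writing \<open>X\<close> as such a sum. All uses
  of \<open>terms\<close> below are in expressions that are linear in each tensor factor, so they do
  not depend on this choice; see \<open>places_cover\<close>, \<open>tensor_terms\<close> and \<open>sum_list_tensor_cong\<close>.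
\<close>

definition tensor :: "('a \<Rightarrow> 'i) set \<Rightarrow> 'i list \<Rightarrow> ('i \<Rightarrow>\<^sub>0 'k) set" where
  "tensor G xs = tensor_class G (\<Sum>p\<leftarrow>xs. Poly_Mapping.single p 1)"

definition "terms" :: "('a \<Rightarrow> 'i) set \<Rightarrow> ('i \<Rightarrow>\<^sub>0 'k) set \<Rightarrow> 'i list" where
  "terms G X = (SOME xs. tensor G xs = X)"

lemma tensor_class_eq_iff:
  "tensor_class G f = tensor_class G h \<longleftrightarrow> f - h \<in> free.span (tensor_relations G)"
proof
  assume "tensor_class G f = tensor_class G h"
  moreover have "f \<in> tensor_class G f"
    by (simp add: tensor_class_def free.span_zero)
  ultimately show "f - h \<in> free.span (tensor_relations G)"
    by (simp add: tensor_class_def)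
next
  assume *: "f - h \<in> free.span (tensor_relations G)"
  have "k - f \<in> free.span (tensor_relations G) \<longleftrightarrow> k - h \<in> free.span (tensor_relations G)" for k
    using free.span_add_eq2[OF *, of "k - f"] by simp
  then show "tensor_class G f = tensor_class G h"
    by (simp add: tensor_class_def)
qed

lemma tensor_terms:
  assumes G: "\<And>p. \<exists>g\<in>G. p \<in> range g" and X: "X \<in> tensor_space G"
  shows "tensor G (terms G X) = X"
proof -
  let ?N = "free.span (tensor_relations G)"
  have "\<exists>xs. (\<Sum>p\<leftarrow>xs. Poly_Mapping.single p 1) - f \<in> ?N" for f :: "_ \<Rightarrow>\<^sub>0 'k"
  proof (induction f rule: update_induct)
    case const
    have "(\<Sum>p\<leftarrow>[]. Poly_Mapping.single p 1) - 0 \<in> ?N"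
      by (simp add: free.span_zero)
    then show ?case by (metis single_zero)
  next
    case (update f p c)
    then obtain xs where xs: "(\<Sum>p\<leftarrow>xs. Poly_Mapping.single p 1) - f \<in> ?N"
      by blast
    obtain g x where g: "g \<in> G" "p = g x"
      using G[of p] by auto
    have "Poly_Mapping.single (g (c *s x)) 1 - free_scale c (Poly_Mapping.single (g x) 1) \<in> ?N"
      using g(1) unfolding tensor_relations_def by (intro free.span_base) blast
    moreover have "Poly_Mapping.update p c f = f + free_scale c (Poly_Mapping.single (g x) 1)"
      using update(1) by (intro poly_mapping_eqI)
        (auto simp: g(2) lookup_update lookup_add lookup_single when_def in_keys_iff)
    ultimately have "(\<Sum>q\<leftarrow>g (c *s x) # xs. Poly_Mapping.single q 1) - Poly_Mapping.update p c f \<in> ?N"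
      using free.span_add[OF _ xs] by (fastforce simp: algebra_simps)
    then show ?case by blast
  qed
  then have "\<exists>xs. tensor G xs = X"
    using X by (auto simp: tensor_space_def tensor_def tensor_class_eq_iff)
  then show ?thesis
    unfolding terms_def by (rule someI_ex)
qed

lemma sum_list_tensor_cong:
  assumes V: "vector_space scaleV" and W: "module.subspace scaleV W"
    and add: "\<And>g x y. g \<in> G \<Longrightarrow> F (g (x + y)) - F (g x) - F (g y) \<in> W"
    and scale: "\<And>g c x. g \<in> G \<Longrightarrow> F (g (c *s x)) - scaleV c (F (g x)) \<in> W"
    and eq: "tensor G xs = tensor G ys"
  shows "(\<Sum>p\<leftarrow>xs. F p) - (\<Sum>p\<leftarrow>ys. F p) \<in> W"
proof -
  interpret V: vector_space scaleV by (rule V)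
  define L where "L f = (\<Sum>p\<in>Poly_Mapping.keys f. scaleV (Poly_Mapping.lookup f p) (F p))" for f
  have L_eq: "L f = (\<Sum>p\<in>A. scaleV (Poly_Mapping.lookup f p) (F p))"
    if "finite A" "Poly_Mapping.keys f \<subseteq> A" for f A
    unfolding L_def using that by (intro sum.mono_neutral_left) (auto simp: in_keys_iff)
  have L_add: "L (f + h) = L f + L h" for f h
  proof -
    let ?A = "Poly_Mapping.keys f \<union> Poly_Mapping.keys h"
    have "Poly_Mapping.keys (f + h) \<subseteq> ?A"
      by (rule Poly_Mapping.keys_add)
    then show ?thesis
      by (simp add: L_eq[of ?A] lookup_add V.scale_left_distrib sum.distrib)
  qed
  have L_scale: "L (free_scale c f) = scaleV c (L f)" for c f
  proof -
    have "Poly_Mapping.keys (free_scale c f) \<subseteq> Poly_Mapping.keys f"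
      by (auto simp: in_keys_iff)
    then show ?thesis
      by (simp add: L_eq[of "Poly_Mapping.keys f"] V.scale_sum_right)
  qed
  interpret L: module_hom free_scale scaleV L
    by unfold_locales (auto simp: L_add L_scale)
  have L_single: "L (Poly_Mapping.single p 1) = F p" for p
    by (simp add: L_def)
  have L_sum: "L (\<Sum>p\<leftarrow>zs. Poly_Mapping.single p 1) = (\<Sum>p\<leftarrow>zs. F p)" for zs
    by (induction zs) (simp_all add: L.zero L_add L_single)
  have "tensor_relations G \<subseteq> {f. L f \<in> W}"
    using add scale by (auto simp: tensor_relations_def L.diff L_scale L_single)
  moreover have "free.subspace {f. L f \<in> W}"
    using W by (auto simp: free.subspace_def V.subspace_def L_add L_scale L.zero)
  ultimately have "free.span (tensor_relations G) \<subseteq> {f. L f \<in> W}"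
    by (rule free.span_minimal)
  then have "L ((\<Sum>p\<leftarrow>xs. Poly_Mapping.single p 1) - (\<Sum>p\<leftarrow>ys. Poly_Mapping.single p 1)) \<in> W"
    using eq unfolding tensor_def tensor_class_eq_iff by blast
  then show ?thesis
    by (simp add: L.diff L_sum)
qed

abbreviation "tensor2 \<equiv> tensor places2"
abbreviation "tensor3 \<equiv> tensor places3"
abbreviation "tensor4 \<equiv> tensor places4"

abbreviation "terms2 \<equiv> terms places2"
abbreviation "terms3 \<equiv> terms places3"
abbreviation "terms4 \<equiv> terms places4"

definition mult2 (infixl \<open>\<cdot>\<^sub>2\<close> 70) where
  "X \<cdot>\<^sub>2 Y = tensor2 [(x * x', y * y'). (x, y) \<leftarrow> terms2 X, (x', y') \<leftarrow> terms2 Y]"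

definition mult3 (infixl \<open>\<cdot>\<^sub>3\<close> 70) where
  "X \<cdot>\<^sub>3 Y = tensor3 [(x * x', y * y', z * z').
     (x, y, z) \<leftarrow> terms3 X, (x', y', z') \<leftarrow> terms3 Y]"

definition mult4 (infixl \<open>\<cdot>\<^sub>4\<close> 70) where
  "X \<cdot>\<^sub>4 Y = tensor4 [(x * x', y * y', z * z', w * w').
     (x, y, z, w) \<leftarrow> terms4 X, (x', y', z', w') \<leftarrow> terms4 Y]"

abbreviation "one2 \<equiv> tensor2 [(1, 1)]"
abbreviation "one3 \<equiv> tensor3 [(1, 1, 1)]"

end


section \<open>Quasitriangular quasi-Hopf algebras\<close>

text \<open>
  \<open>\<Phi>'\<close> is the inverse of \<open>\<Phi>\<close>. The equations for \<open>\<Delta> (a + b)\<close> and \<open>\<Delta> (c *s a)\<close> express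
  that \<open>\<Delta>\<close> is linear, since joining two lists of terms adds the tensors.
\<close>

locale quasi_bialgebra = unital_algebra scale
  for scale :: "'k::field \<Rightarrow> 'a::ring_1 \<Rightarrow> 'a" (infixr \<open>*s\<close> 75) +
  fixes \<Delta> :: "'a \<Rightarrow> ('a \<times> 'a \<Rightarrow>\<^sub>0 'k) set"
    and \<epsilon> :: "'a \<Rightarrow> 'k"
    and \<Phi> \<Phi>' :: "('a \<times> 'a \<times> 'a \<Rightarrow>\<^sub>0 'k) set"
  assumes comult_in: "\<Delta> a \<in> tensor_space places2"
    and comult_add: "\<Delta> (a + b) = tensor2 (terms2 (\<Delta> a) @ terms2 (\<Delta> b))"
    and comult_scale: "\<Delta> (c *s a) = tensor2 [(c *s x, y). (x, y) \<leftarrow> terms2 (\<Delta> a)]"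
    and comult_mult: "\<Delta> (a * b) = \<Delta> a \<cdot>\<^sub>2 \<Delta> b"
    and comult_one: "\<Delta> 1 = one2"
    and counit_linear: "Vector_Spaces.linear scale (*) \<epsilon>"
    and counit_mult: "\<epsilon> (a * b) = \<epsilon> a * \<epsilon> b"
    and counit_one: "\<epsilon> 1 = 1"
    and assoc_in: "\<Phi> \<in> tensor_space places3" "\<Phi>' \<in> tensor_space places3"
    and assoc_inverse: "\<Phi> \<cdot>\<^sub>3 \<Phi>' = one3" "\<Phi>' \<cdot>\<^sub>3 \<Phi> = one3"
    and quasi_coassoc:
      "tensor3 [(x, y1, y2). (x, y) \<leftarrow> terms2 (\<Delta> a), (y1, y2) \<leftarrow> terms2 (\<Delta> y)] \<cdot>\<^sub>3 \<Phi> =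
       \<Phi> \<cdot>\<^sub>3 tensor3 [(x1, x2, y). (x, y) \<leftarrow> terms2 (\<Delta> a), (x1, x2) \<leftarrow> terms2 (\<Delta> x)]"
    and pentagon:
      "tensor4 [(x, y, z1, z2). (x, y, z) \<leftarrow> terms3 \<Phi>, (z1, z2) \<leftarrow> terms2 (\<Delta> z)] \<cdot>\<^sub>4
       tensor4 [(x1, x2, y, z). (x, y, z) \<leftarrow> terms3 \<Phi>, (x1, x2) \<leftarrow> terms2 (\<Delta> x)] =
       tensor4 [(1, x, y, z). (x, y, z) \<leftarrow> terms3 \<Phi>] \<cdot>\<^sub>4
       tensor4 [(x, y1, y2, z). (x, y, z) \<leftarrow> terms3 \<Phi>, (y1, y2) \<leftarrow> terms2 (\<Delta> y)] \<cdot>\<^sub>4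
       tensor4 [(x, y, z, 1). (x, y, z) \<leftarrow> terms3 \<Phi>]"
    and counit_left: "(\<Sum>(x, y)\<leftarrow>terms2 (\<Delta> a). \<epsilon> x *s y) = a"
    and counit_right: "(\<Sum>(x, y)\<leftarrow>terms2 (\<Delta> a). \<epsilon> y *s x) = a"
    and counit_assoc: "tensor2 [(x, \<epsilon> y *s z). (x, y, z) \<leftarrow> terms3 \<Phi>] = one2"

locale quasi_hopf_algebra = quasi_bialgebra scale \<Delta> \<epsilon> \<Phi> \<Phi>'
  for scale :: "'k::field \<Rightarrow> 'a::ring_1 \<Rightarrow> 'a" (infixr \<open>*s\<close> 75)
    and \<Delta> \<epsilon> \<Phi> \<Phi>' +
  fixes S :: "'a \<Rightarrow> 'a" and \<alpha> \<beta> :: 'a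
  assumes antipode_linear: "Vector_Spaces.linear scale scale S"
    and antipode_bij: "bij S"
    and antipode_mult: "S (a * b) = S b * S a"
    and antipode_one: "S 1 = 1"
    and antipode_left: "(\<Sum>(x, y)\<leftarrow>terms2 (\<Delta> a). S x * \<alpha> * y) = \<epsilon> a *s \<alpha>"
    and antipode_right: "(\<Sum>(x, y)\<leftarrow>terms2 (\<Delta> a). x * \<beta> * S y) = \<epsilon> a *s \<beta>"
    and antipode_assoc: "(\<Sum>(X, Y, Z)\<leftarrow>terms3 \<Phi>. X * \<beta> * S Y * \<alpha> * Z) = 1"
    and antipode_assoc_inverse: "(\<Sum>(X, Y, Z)\<leftarrow>terms3 \<Phi>'. S X * \<alpha> * Y * \<beta> * S Z) = 1"

locale quasitriangular_quasi_hopf_algebra = quasi_hopf_algebra scale \<Delta> \<epsilon> \<Phi> \<Phi>' S \<alpha> \<beta>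
  for scale :: "'k::field \<Rightarrow> 'a::ring_1 \<Rightarrow> 'a" (infixr \<open>*s\<close> 75)
    and \<Delta> \<epsilon> \<Phi> \<Phi>' S \<alpha> \<beta> +
  fixes R :: "('a \<times> 'a \<Rightarrow>\<^sub>0 'k) set"
  assumes R_in: "R \<in> tensor_space places2"
    and R_invertible: "\<exists>R'\<in>tensor_space places2. R \<cdot>\<^sub>2 R' = one2 \<and> R' \<cdot>\<^sub>2 R = one2"
    and R_comult: "tensor2 [(y, x). (x, y) \<leftarrow> terms2 (\<Delta> a)] \<cdot>\<^sub>2 R = R \<cdot>\<^sub>2 \<Delta> a"
    and hexagon_left:
      "tensor3 [(s1, s2, t). (s, t) \<leftarrow> terms2 R, (s1, s2) \<leftarrow> terms2 (\<Delta> s)] =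
       tensor3 [(Yi * s * Xj * Xk, Zi * Zj * s' * Yk, Xi * t * Yj * t' * Zk).
         (Xi, Yi, Zi) \<leftarrow> terms3 \<Phi>, (Xj, Yj, Zj) \<leftarrow> terms3 \<Phi>', (Xk, Yk, Zk) \<leftarrow> terms3 \<Phi>,
         (s, t) \<leftarrow> terms2 R, (s', t') \<leftarrow> terms2 R]"
    and hexagon_right:
      "tensor3 [(s, t1, t2). (s, t) \<leftarrow> terms2 R, (t1, t2) \<leftarrow> terms2 (\<Delta> t)] =
       tensor3 [(Zi * s * Yj * s' * Xk, Xi * Xj * t' * Yk, Yi * t * Zj * Zk).
         (Xi, Yi, Zi) \<leftarrow> terms3 \<Phi>', (Xj, Yj, Zj) \<leftarrow> terms3 \<Phi>, (Xk, Yk, Zk) \<leftarrow> terms3 \<Phi>',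
         (s, t) \<leftarrow> terms2 R, (s', t') \<leftarrow> terms2 R]"
begin

definition drinfeld_element :: 'a where
  "drinfeld_element =
     (\<Sum>(X, Y, Z)\<leftarrow>terms3 \<Phi>'. \<Sum>(s, t)\<leftarrow>terms2 R. S (Y * \<beta> * S Z) * S t * \<alpha> * s * X)"

text \<open>
  The Drinfel'd element of the opposite and coopposite algebra, written with the product of the
  algebra itself: in \<open>drinfeld_element\<close> the products are reversed, \<open>\<alpha>\<close> and \<open>\<beta>\<close> are exchanged,
  and so are the outer factors of \<open>\<Phi>'\<close>; \<open>R\<close> and \<open>S\<close> stay the same.
\<close>

definition opcop_drinfeld_element :: 'a where
  "opcop_drinfeld_element =
     (\<Sum>(X, Y, Z)\<leftarrow>terms3 \<Phi>'. \<Sum>(s, t)\<leftarrow>terms2 R. Z * s * \<beta> * S t * S (S X * \<alpha> * Y))"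

end

end

theory Submission
  imports Defs
begin

text \<open>
  Let \<open>q = S (\<Sum> s * \<beta> * S t)\<close>. Since \<open>R\<close> intertwines the coproduct with its opposite, \<open>q\<close> is
  invariant: \<open>S (S a\<^sub>1) * q * S a\<^sub>2 = \<epsilon> a *s q\<close>. Graphically, \<open>q\<close> is a map from the unit
  to \<open>V** \<otimes> V*\<close>, and bending one leg turns it into a map \<open>w\<close> from \<open>V\<close> to \<open>V**\<close>,
  namely \<open>w = transfer q = \<Sum> S (S X) * q * S Y * \<alpha> * Z\<close>. Quasi-coassociativity gives
  \<open>S (S a) * w = w * a\<close>, and the pentagon gives the zigzag identity \<open>w * \<beta> = q\<close>. Hence
  \<open>S u' = \<Sum> S (S (S X' * \<alpha> * Y')) * w * \<beta> * S Z' = w * (\<Sum> S X' * \<alpha> * Y' * \<beta> * S Z') = w\<close>, where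
  \<open>u'\<close> is the Drinfel'd element of the opposite coopposite algebra.

  It remains to identify \<open>w\<close> with the Drinfel'd element. On the strands \<open>1\<close>, \<open>2\<close>, \<open>3\<close> labelled
  \<open>V\<close>, \<open>V*\<close>, \<open>V**\<close> the two hexagons give, with no appeal to coherence,
  \<open>\<Phi>\<^sub>3\<^sub>2\<^sub>1 R\<^sub>2\<^sub>3 (id \<otimes> \<Delta>)(R)\<^sub>1\<^sub>2\<^sub>3 = (\<Delta> \<otimes> id)(R)\<^sub>2\<^sub>1\<^sub>3 R\<^sub>1\<^sub>2 \<Phi>'\<^sub>1\<^sub>2\<^sub>3\<close>.
  Creating the strands \<open>2\<close>, \<open>3\<close> by \<open>\<beta>\<close> and closing the strands \<open>2\<close>, \<open>1\<close> by \<open>\<alpha>\<close> cancels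
  the two factors in which \<open>R\<close> is expanded, and leaves \<open>w\<close> on the left and the Drinfel'd element
  on the right.
\<close>

lemma sum_list_concat: "sum_list (concat xss) = (\<Sum>xs\<leftarrow>xss. sum_list xs)"
  by (induction xss) simp_all

lemma sum_list_swap:
  fixes f :: "'b \<Rightarrow> 'c \<Rightarrow> 'd::comm_monoid_add"
  shows "(\<Sum>x\<leftarrow>xs. \<Sum>y\<leftarrow>ys. f x y) = (\<Sum>y\<leftarrow>ys. \<Sum>x\<leftarrow>xs. f x y)"
  by (induction xs) (simp_all add: sum_list_addf)

section \<open>Multilinear evaluation of tensors\<close>

context unital_algebra
begin

section \<open>Linear and multilinear maps of up to four arguments\<close>

definition lin :: "('a \<Rightarrow> 'a) \<Rightarrow> bool" where
  "lin f \<longleftrightarrow> (\<forall>x y. f (x + y) = f x + f y) \<and> (\<forall>c x. f (c *s x) = c *s f x)"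

lemma lin_add: "lin f \<Longrightarrow> f (x + y) = f x + f y"
  and lin_scale: "lin f \<Longrightarrow> f (c *s x) = c *s f x"
  by (simp_all add: lin_def)

lemma lin_sum_list:
  assumes "lin f"
  shows "f (\<Sum>x\<leftarrow>xs. g x) = (\<Sum>x\<leftarrow>xs. f (g x))"
  \<comment> \<open>Scaling by \<open>0\<close> gives \<open>f 0 = 0\<close>, which settles the
    empty list.\<close>
  by (induction xs) (use lin_scale[OF assms, of 0 0] in \<open>simp_all add: lin_add[OF assms]\<close>)

definition bilin :: "('a \<Rightarrow> 'a \<Rightarrow> 'a) \<Rightarrow> bool" where
  "bilin f \<longleftrightarrow> (\<forall>y. lin (\<lambda>x. f x y)) \<and> (\<forall>x. lin (\<lambda>y. f x y))"

definition trilin :: "('a \<Rightarrow> 'a \<Rightarrow> 'a \<Rightarrow> 'a) \<Rightarrow> bool" where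
  "trilin f \<longleftrightarrow> (\<forall>y z. lin (\<lambda>x. f x y z)) \<and> (\<forall>x z. lin (\<lambda>y. f x y z)) \<and>
    (\<forall>x y. lin (\<lambda>z. f x y z))"

definition quadrilin :: "('a \<Rightarrow> 'a \<Rightarrow> 'a \<Rightarrow> 'a \<Rightarrow> 'a) \<Rightarrow> bool" where
  "quadrilin f \<longleftrightarrow> (\<forall>y z w. lin (\<lambda>x. f x y z w)) \<and> (\<forall>x z w. lin (\<lambda>y. f x y z w)) \<and>
    (\<forall>x y w. lin (\<lambda>z. f x y z w)) \<and> (\<forall>x y z. lin (\<lambda>w. f x y z w))"

lemmas multilin_defs = bilin_def trilin_def quadrilin_def

lemma bilinI:
  assumes "\<And>y. lin (\<lambda>x. f x y)" and "\<And>x. lin (\<lambda>y. f x y)"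
  shows "bilin f"
  using assms by (simp add: bilin_def)

lemma trilinI:
  assumes "\<And>y z. lin (\<lambda>x. f x y z)" and "\<And>x z. lin (\<lambda>y. f x y z)" and "\<And>x y. lin (\<lambda>z. f x y z)"
  shows "trilin f"
  using assms by (simp add: trilin_def)

lemma quadrilinI:
  assumes "\<And>y z w. lin (\<lambda>x. f x y z w)" and "\<And>x z w. lin (\<lambda>y. f x y z w)"
    and "\<And>x y w. lin (\<lambda>z. f x y z w)" and "\<And>x y z. lin (\<lambda>w. f x y z w)"
  shows "quadrilin f"
  using assms by (simp add: quadrilin_def)

lemmas multilinI = bilinI trilinI quadrilinI

lemma lin_comp: "lin f \<Longrightarrow> lin g \<Longrightarrow> lin (\<lambda>x. f (g x))"
  by (simp add: lin_def)

lemma lin_bilin: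
  assumes "bilin f" and "lin g"
  shows "lin (\<lambda>x. f (g x) b)" and "lin (\<lambda>x. f a (g x))"
  using assms by (simp_all add: bilin_def lin_def)

lemma lin_trilin:
  assumes "trilin f" and "lin g"
  shows "lin (\<lambda>x. f (g x) b c)" and "lin (\<lambda>x. f a (g x) c)" and "lin (\<lambda>x. f a b (g x))"
  using assms by (simp_all add: trilin_def lin_def)

lemma lin_quadrilin:
  assumes "quadrilin f" and "lin g"
  shows "lin (\<lambda>x. f (g x) b c d)" and "lin (\<lambda>x. f a (g x) c d)"
    and "lin (\<lambda>x. f a b (g x) d)" and "lin (\<lambda>x. f a b c (g x))"
  using assms by (simp_all add: quadrilin_def lin_def)

text \<open>For bilinear \<open>f\<close> this is the map that \<open>f\<close> induces on the
  tensor square; bilinearity is what frees it from the list chosen by \<open>terms2\<close>.\<close>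

definition eval2 :: "('a \<times> 'a \<Rightarrow>\<^sub>0 'k) set \<Rightarrow> ('a \<Rightarrow> 'a \<Rightarrow> 'a) \<Rightarrow> 'a" where
  "eval2 X f = (\<Sum>(x, y)\<leftarrow>terms2 X. f x y)"

definition eval3 :: "('a \<times> 'a \<times> 'a \<Rightarrow>\<^sub>0 'k) set \<Rightarrow> ('a \<Rightarrow> 'a \<Rightarrow> 'a \<Rightarrow> 'a) \<Rightarrow> 'a" where
  "eval3 X f = (\<Sum>(x, y, z)\<leftarrow>terms3 X. f x y z)"

definition eval4 ::
  "('a \<times> 'a \<times> 'a \<times> 'a \<Rightarrow>\<^sub>0 'k) set \<Rightarrow> ('a \<Rightarrow> 'a \<Rightarrow> 'a \<Rightarrow> 'a \<Rightarrow> 'a) \<Rightarrow> 'a" where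
  "eval4 X f = (\<Sum>(x, y, z, w)\<leftarrow>terms4 X. f x y z w)"

lemmas eval_defs = eval2_def eval3_def eval4_def

lemma tensor_terms_tensor:
  assumes "\<And>p. \<exists>g\<in>G. p \<in> range g"
  shows "tensor G (terms G (tensor G xs)) = tensor G xs"
  using assms by (rule tensor_terms) (simp add: tensor_space_def tensor_def)

lemma sum_list_tensor_eq:
  assumes "\<And>g x y. g \<in> G \<Longrightarrow> F (g (x + y)) = F (g x) + F (g y)"
    and "\<And>g c x. g \<in> G \<Longrightarrow> F (g (c *s x)) = c *s F (g x)"
    and "tensor G xs = tensor G ys"
  shows "(\<Sum>p\<leftarrow>xs. F p) = (\<Sum>p\<leftarrow>ys. F p :: 'a)"
proof -
  have "(\<Sum>p\<leftarrow>xs. F p) - (\<Sum>p\<leftarrow>ys. F p) \<in> {0}"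
    using assms
    by (intro sum_list_tensor_cong[OF vector_space_axioms]) (simp_all add: subspace_def)
  then show ?thesis by simp
qed

text \<open>The chosen list \<open>terms2 (tensor2 xs)\<close> and \<open>xs\<close> may differ, but
  they represent one tensor, and a bilinear map respects the relations defining it.\<close>

lemma eval2_tensor:
  assumes "bilin f"
  shows "eval2 (tensor2 xs) f = (\<Sum>(x, y)\<leftarrow>xs. f x y)"
  unfolding eval_defs
  by (rule sum_list_tensor_eq[OF _ _ tensor_terms_tensor[OF places_cover(1)]])
    (use assms in \<open>auto simp: places2_def multilin_defs lin_def\<close>)

lemma eval3_tensor:
  assumes "trilin f"
  shows "eval3 (tensor3 xs) f = (\<Sum>(x, y, z)\<leftarrow>xs. f x y z)"
  unfolding eval_defs
  by (rule sum_list_tensor_eq[OF _ _ tensor_terms_tensor[OF places_cover(2)]])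
    (use assms in \<open>auto simp: places3_def multilin_defs lin_def\<close>)

lemma eval4_tensor:
  assumes "quadrilin f"
  shows "eval4 (tensor4 xs) f = (\<Sum>(x, y, z, w)\<leftarrow>xs. f x y z w)"
  unfolding eval_defs
  by (rule sum_list_tensor_eq[OF _ _ tensor_terms_tensor[OF places_cover(3)]])
    (use assms in \<open>auto simp: places4_def multilin_defs lin_def\<close>)

lemmas sum_list_comprehension = split_def map_concat comp_def sum_list_concat

lemma eval2_mult:
  assumes "bilin f"
  shows "eval2 (X \<cdot>\<^sub>2 Y) f = eval2 X (\<lambda>x y. eval2 Y (\<lambda>x' y'. f (x * x') (y * y')))"
  unfolding mult2_def eval2_tensor[OF assms] by (simp add: eval_defs sum_list_comprehension)

lemma eval3_mult:
  assumes "trilin f"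
  shows "eval3 (X \<cdot>\<^sub>3 Y) f = eval3 X (\<lambda>x y z. eval3 Y (\<lambda>x' y' z'. f (x * x') (y * y') (z * z')))"
  unfolding mult3_def eval3_tensor[OF assms] by (simp add: eval_defs sum_list_comprehension)

lemma eval4_mult:
  assumes "quadrilin f"
  shows "eval4 (X \<cdot>\<^sub>4 Y) f =
    eval4 X (\<lambda>x y z w. eval4 Y (\<lambda>x' y' z' w'. f (x * x') (y * y') (z * z') (w * w')))"
  unfolding mult4_def eval4_tensor[OF assms] by (simp add: eval_defs sum_list_comprehension)

lemma eval2_eval2_swap:
    "eval2 X (\<lambda>x y. eval2 X' (\<lambda>x' y'. h x y x' y')) =
      eval2 X' (\<lambda>x' y'. eval2 X (\<lambda>x y. h x y x' y'))"
  and eval2_eval3_swap: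
    "eval2 X (\<lambda>x y. eval3 Y (\<lambda>x' y' z'. f x y x' y' z')) =
      eval3 Y (\<lambda>x' y' z'. eval2 X (\<lambda>x y. f x y x' y' z'))"
  and eval3_eval3_swap:
    "eval3 Z (\<lambda>x y z. eval3 Y (\<lambda>x' y' z'. g x y z x' y' z')) =
      eval3 Y (\<lambda>x' y' z'. eval3 Z (\<lambda>x y z. g x y z x' y' z'))"
  unfolding eval_defs split_def by (rule sum_list_swap)+

lemma eval_lin:
  assumes "lin f"
  shows "f (eval2 X2 g2) = eval2 X2 (\<lambda>x y. f (g2 x y))"
    and "f (eval3 X3 g3) = eval3 X3 (\<lambda>x y z. f (g3 x y z))"
  by (simp_all add: eval_defs split_def lin_sum_list[OF assms])

lemma lin_id: "lin (\<lambda>x. x)"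
  and lin_mult_left: "lin f \<Longrightarrow> lin (\<lambda>x. f x * a)"
  and lin_mult_right: "lin f \<Longrightarrow> lin (\<lambda>x. a * f x)"
  and lin_scale_right: "lin f \<Longrightarrow> lin (\<lambda>x. c *s f x)"
  by (simp_all add: lin_def algebra_simps scale_mult_left scale_mult_right)

lemma eval2_scale: "eval2 X (\<lambda>x y. c *s f x y) = c *s eval2 X f"
  and eval3_scale: "eval3 Y (\<lambda>x y z. c *s g x y z) = c *s eval3 Y g"
  by (simp_all add: eval_lin[OF lin_scale_right[OF lin_id]])

lemma lin_sum_list_fun:
  assumes "\<And>p. lin (f p)"
  shows "lin (\<lambda>x. \<Sum>p\<leftarrow>ps. f p x)"
  by (induction ps) (use assms in \<open>simp_all add: lin_def scale_right_distrib add_ac\<close>)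

lemma lin_eval2: "(\<And>a b. lin (f a b)) \<Longrightarrow> lin (\<lambda>x. eval2 X (\<lambda>a b. f a b x))"
  and lin_eval3: "(\<And>a b c. lin (g a b c)) \<Longrightarrow> lin (\<lambda>x. eval3 Y (\<lambda>a b c. g a b c x))"
  and lin_eval4: "(\<And>a b c d. lin (h a b c d)) \<Longrightarrow> lin (\<lambda>x. eval4 Z (\<lambda>a b c d. h a b c d x))"
  unfolding eval_defs split_def by (simp_all add: lin_sum_list_fun)

lemmas lin_intros = lin_id lin_mult_left lin_mult_right lin_scale_right lin_eval2 lin_eval3
    lin_eval4

end

section \<open>Quasi-bialgebras\<close>

context quasi_bialgebra
begin

text \<open>The axioms \<open>comult_add\<close> and \<open>comult_scale\<close> equate tensors
  given by lists; a bilinear test map turns them into linearity in \<open>a\<close>.\<close>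

lemma lin_eval2_comult:
  assumes "bilin f"
  shows "lin (\<lambda>a. eval2 (\<Delta> a) f)"
proof -
  have cs: "f (c *s x) y = c *s f x y" for c x y
    using assms by (simp add: bilin_def lin_def)
  have "eval2 (\<Delta> (a + b)) f = eval2 (\<Delta> a) f + eval2 (\<Delta> b) f" for a b
    unfolding comult_add eval2_tensor[OF assms] by (simp add: eval_defs)
  moreover have "eval2 (\<Delta> (c *s a)) f = c *s eval2 (\<Delta> a) f" for c a
    unfolding comult_scale eval2_tensor[OF assms]
    by (simp add: eval_defs split_def comp_def cs lin_sum_list[OF lin_scale_right[OF lin_id]])
  ultimately show ?thesis by (simp add: lin_def)
qed

lemma lin_comult: "bilin f \<Longrightarrow> lin g \<Longrightarrow> lin (\<lambda>x. eval2 (\<Delta> (g x)) f)"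
  by (rule lin_comp[OF lin_eval2_comult])

lemma counit_add: "\<epsilon> (x + y) = \<epsilon> x + \<epsilon> y"
  and counit_scale: "\<epsilon> (c *s x) = c * \<epsilon> x"
  using counit_linear by (simp_all add: Vector_Spaces.linear_iff)

lemma lin_counit: "lin f \<Longrightarrow> lin (\<lambda>x. \<epsilon> (f x) *s a)"
  by (simp add: lin_def counit_add counit_scale scale_left_distrib)

lemmas lin_bialgebra = lin_intros lin_comult lin_counit

lemma eval_counit_left: "lin f \<Longrightarrow> eval2 (\<Delta> a) (\<lambda>x y. \<epsilon> x *s f y) = f a"
  and eval_counit_right: "lin f \<Longrightarrow> eval2 (\<Delta> a) (\<lambda>x y. \<epsilon> y *s f x) = f a"
  using lin_sum_list[of f "\<lambda>(x, y). \<epsilon> x *s y" "terms2 (\<Delta> a)"]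
    lin_sum_list[of f "\<lambda>(x, y). \<epsilon> y *s x" "terms2 (\<Delta> a)"]
  by (simp_all add: eval_defs split_def counit_left[unfolded split_def]
    counit_right[unfolded split_def] lin_def)

lemma eval_assoc_inverse:
  assumes "trilin f"
  shows "eval3 \<Phi> (\<lambda>x y z. eval3 \<Phi>' (\<lambda>x' y' z'. f (x * x') (y * y') (z * z'))) = f 1 1 1"
    and "eval3 \<Phi>' (\<lambda>x y z. eval3 \<Phi> (\<lambda>x' y' z'. f (x * x') (y * y') (z * z'))) = f 1 1 1"
  unfolding eval3_mult[OF assms, symmetric] assoc_inverse eval3_tensor[OF assms] by simp_all

section \<open>The associator axioms tested on multilinear maps\<close>

lemma eval_quasi_coassoc:
  assumes "trilin f"
  shows "eval2 (\<Delta> a) (\<lambda>x y. eval2 (\<Delta> y) (\<lambda>y1 y2. eval3 \<Phi> (\<lambda>X Y Z. f (x * X) (y1 * Y) (y2 * Z)))) =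
    eval3 \<Phi> (\<lambda>X Y Z. eval2 (\<Delta> a) (\<lambda>x y. eval2 (\<Delta> x) (\<lambda>x1 x2. f (X * x1) (Y * x2) (Z * y))))"
proof -
  \<comment> \<open>Evaluating a product leaves a function with one factor absorbed; it must be
    trilinear again before the other factor can be replaced by its list.\<close>
  have *: "trilin (\<lambda>x y z. eval3 \<Phi> (\<lambda>X Y Z. f (x * X) (y * Y) (z * Z)))"
    "\<And>X Y Z. trilin (\<lambda>x y z. f (X * x) (Y * y) (Z * z))"
    by (intro multilinI lin_intros lin_trilin[OF assms])+
  show ?thesis
    using arg_cong[where f="\<lambda>X. eval3 X f", OF quasi_coassoc[of a]]
    unfolding eval3_mult[OF assms] eval3_tensor[OF *(1)] eval3_tensor[OF *(2)]
    by (simp add: eval_defs sum_list_comprehension)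
qed

lemma eval_pentagon:
  assumes f: "quadrilin f"
  shows "eval3 \<Phi> (\<lambda>X Y Z. eval2 (\<Delta> Z) (\<lambda>Z1 Z2.
      eval3 \<Phi> (\<lambda>X' Y' Z'. eval2 (\<Delta> X') (\<lambda>X1 X2. f (X * X1) (Y * X2) (Z1 * Y') (Z2 * Z'))))) =
    eval3 \<Phi> (\<lambda>X Y Z. eval3 \<Phi> (\<lambda>X' Y' Z'. eval2 (\<Delta> Y') (\<lambda>Y1 Y2.
      eval3 \<Phi> (\<lambda>X'' Y'' Z''. f (X' * X'') (X * Y1 * Y'') (Y * Y2 * Z'') (Z * Z')))))"
proof -
  let ?m = "\<lambda>g x y z w x' y' z' w'. g (x * x') (y * y') (z * z') (w * w') :: 'a"
  \<comment> \<open>The right side of the pentagon is a threefold product, so up to two factors are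
    absorbed into the test map.\<close>
  have *: "quadrilin (?m g a b c d)"
    "quadrilin (\<lambda>x y z w. eval4 T (?m g x y z w))"
    "quadrilin (\<lambda>x y z w. eval4 T (?m (\<lambda>x y z w. eval4 T' (?m g x y z w)) x y z w))"
    if g: "quadrilin g" for g T T' a b c d
    by (intro multilinI lin_intros lin_quadrilin[OF g])+
  show ?thesis
    using arg_cong[where f="\<lambda>X. eval4 X f", OF pentagon]
    unfolding eval4_mult[OF f] eval4_mult[OF *(2)[OF f]]
    unfolding eval4_tensor[OF *(3)[OF f]] eval4_tensor[OF *(2)[OF f]]
    unfolding eval4_tensor[OF *(1)[OF *(2)[OF f]]]
    unfolding eval4_tensor[OF *(1)[OF f]]
    by (simp add: eval_defs sum_list_comprehension mult.assoc)
qed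

section \<open>The counit applied to single factors of \<Phi> and of its inverse\<close>

lemma eval_counit_assoc_middle:
  assumes "bilin f"
  shows "eval3 \<Phi> (\<lambda>X Y Z. \<epsilon> Y *s f X Z) = f 1 1"
proof -
  have "f x (c *s y) = c *s f x y" for c x y
    using assms by (simp add: bilin_def lin_def)
  then show ?thesis
    using arg_cong[where f="\<lambda>X. eval2 X f", OF counit_assoc]
    unfolding eval2_tensor[OF assms] by (simp add: eval_defs split_def comp_def)
qed

lemma eval_comult_one: "bilin f \<Longrightarrow> eval2 (\<Delta> 1) f = f 1 1"
  by (simp add: comult_one eval2_tensor)

lemmas counit_scale_simps = counit_mult scale_scale mult_ac

text \<open>
  Applying \<open>\<epsilon>\<close> to the second, respectively third, factor of the pentagon leaves \<open>\<Phi>\<close> equal to a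
  product of \<open>\<Phi>\<close> with the factor to be trivialised, and \<open>\<Phi>\<close> is cancelled.
\<close>

lemma eval_counit_assoc_left:
  assumes g: "bilin g"
  shows "eval3 \<Phi> (\<lambda>X Y Z. \<epsilon> X *s g Y Z) = g 1 1"
proof -
  \<comment> \<open>If \<open>e\<close> is \<Phi> with the counit applied to its first factor, this
    says \<Phi> = (1 \<otimes> e) \<Phi>.\<close>
  have *: "eval3 \<Phi> h = eval3 \<Phi> (\<lambda>X Y Z. \<epsilon> X *s eval3 \<Phi> (\<lambda>X' Y' Z'. h X' (Y * Y') (Z * Z')))"
    if h: "trilin h" for h
  proof -
    have f: "quadrilin (\<lambda>a b c d. \<epsilon> b *s h a c d)"
      by (intro multilinI lin_bialgebra lin_trilin[OF h])
    have 1: "eval2 (\<Delta> X') (\<lambda>X1 X2. \<epsilon> (Y * X2) *s h (X * X1) b c) = \<epsilon> Y *s h (X * X') b c"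
      for X Y X' b c
      using eval_counit_right[of "\<lambda>x. \<epsilon> Y *s h (X * x) b c" X']
      by (simp add: lin_intros lin_trilin[OF h] counit_scale_simps)
    have "eval3 \<Phi> (\<lambda>X Y Z. \<epsilon> Y *s eval2 (\<Delta> Z) (\<lambda>Z1 Z2. eval3 \<Phi> (\<lambda>X' Y' Z'.
        h (X * X') (Z1 * Y') (Z2 * Z'))))
      = eval2 (\<Delta> 1) (\<lambda>Z1 Z2. eval3 \<Phi> (\<lambda>X' Y' Z'. h (1 * X') (Z1 * Y') (Z2 * Z')))"
      by (intro eval_counit_assoc_middle multilinI lin_bialgebra lin_trilin[OF h])
    also have "\<dots> = eval3 \<Phi> h"
      by (subst eval_comult_one) (intro multilinI lin_bialgebra lin_trilin[OF h], simp)
    finally have 2: "eval3 \<Phi> (\<lambda>X Y Z. \<epsilon> Y *s eval2 (\<Delta> Z) (\<lambda>Z1 Z2. eval3 \<Phi> (\<lambda>X' Y' Z'.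
      h (X * X') (Z1 * Y') (Z2 * Z')))) = eval3 \<Phi> h" .
    have 3: "eval3 \<Phi> (\<lambda>X'' Y'' Z''. \<epsilon> (a * Y'') *s h (b * X'') (c * Z'') d) =
        \<epsilon> a *s h b c d" for a b c d
      using eval_counit_assoc_middle[of "\<lambda>X'' Z''. \<epsilon> a *s h (b * X'') (c * Z'') d"]
      by (simp add: bilin_def lin_intros lin_trilin[OF h] counit_scale_simps)
    have 4: "eval2 (\<Delta> Y') (\<lambda>Y1 Y2. \<epsilon> (X * Y1) *s h b (Y * Y2) d) =
        \<epsilon> X *s h b (Y * Y') d" for X Y Y' b d
      using eval_counit_left[of "\<lambda>y. \<epsilon> X *s h b (Y * y) d" Y']
      by (simp add: lin_intros lin_trilin[OF h] counit_scale_simps)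
    show ?thesis
      using eval_pentagon[OF f] by (simp add: 1 2 3 4 eval2_scale eval3_scale)
  qed
  have tri: "trilin (\<lambda>a b c. \<epsilon> a *s g b c)"
    by (intro multilinI lin_bialgebra lin_bilin[OF g])
  have tri': "trilin (\<lambda>a b c. \<epsilon> a *s g (Y * b) (Z * c))" for Y Z
    by (intro multilinI lin_bialgebra lin_bilin[OF g])
  \<comment> \<open>This test map multiplies by \<open>\<Phi>'\<close> on the right, which cancels
    \<Phi> on both sides of \<open>*\<close> and isolates \<open>e\<close>.\<close>
  have "trilin (\<lambda>a b c. eval3 \<Phi>' (\<lambda>X Y Z. \<epsilon> (a * X) *s g (b * Y) (c * Z)))"
    by (intro multilinI lin_bialgebra lin_bilin[OF g])
  from *[OF this] show ?thesis
    using eval_assoc_inverse(1)[OF tri] eval_assoc_inverse(1)[OF tri']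
    by (simp add: mult.assoc counit_one)
qed

lemma eval_counit_assoc_right:
  assumes g: "bilin g"
  shows "eval3 \<Phi> (\<lambda>X Y Z. \<epsilon> Z *s g X Y) = g 1 1"
proof -
  \<comment> \<open>If \<open>e\<close> is \<Phi> with the counit applied to its third factor, this
    says \<Phi> = \<Phi> (e \<otimes> 1).\<close>
  have *: "eval3 \<Phi> h = eval3 \<Phi> (\<lambda>X Y Z. eval3 \<Phi> (\<lambda>X' Y' Z'. \<epsilon> Z' *s h (X * X') (Y * Y') Z))"
    if h: "trilin h" for h
  proof -
    have f: "quadrilin (\<lambda>a b c d. \<epsilon> c *s h a b d)"
      by (intro multilinI lin_bialgebra lin_trilin[OF h])
    have 1: "eval3 \<Phi> (\<lambda>X' Y' Z'. eval2 (\<Delta> X') (\<lambda>X1 X2.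
        \<epsilon> (Z1 * Y') *s h (X * X1) (Y * X2) (Z2 * Z')))
      = \<epsilon> Z1 *s h X Y Z2" for X Y Z1 Z2
    proof -
      have "bilin (\<lambda>X' Z'. eval2 (\<Delta> X') (\<lambda>X1 X2. \<epsilon> Z1 *s h (X * X1) (Y * X2) (Z2 * Z')))"
        by (intro multilinI lin_bialgebra lin_trilin[OF h])
      from eval_counit_assoc_middle[OF this] show ?thesis
        by (subst (asm) eval_comult_one) (intro multilinI lin_bialgebra lin_trilin[OF h],
          simp add: counit_mult eval2_scale[symmetric] mult.commute)
    qed
    have 2: "eval2 (\<Delta> Z) (\<lambda>Z1 Z2. \<epsilon> Z1 *s h X Y Z2) = h X Y Z" for X Y Z
      by (rule eval_counit_left) (intro lin_intros lin_trilin[OF h])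
    have "eval3 \<Phi> (\<lambda>X Y Z. \<epsilon> Y *s eval3 \<Phi> (\<lambda>X' Y' Z'. eval2 (\<Delta> Y') (\<lambda>Y1 Y2.
        eval3 \<Phi> (\<lambda>X'' Y'' Z''. \<epsilon> (Y2 * Z'') *s h (X' * X'') (X * Y1 * Y'') (Z * Z')))))
      = eval3 \<Phi> (\<lambda>X' Y' Z'. eval2 (\<Delta> Y') (\<lambda>Y1 Y2.
        eval3 \<Phi> (\<lambda>X'' Y'' Z''. \<epsilon> (Y2 * Z'') *s h (X' * X'') (1 * Y1 * Y'') (1 * Z'))))"
      by (intro eval_counit_assoc_middle multilinI lin_bialgebra lin_trilin[OF h])
    also have "\<dots> = eval3 \<Phi> (\<lambda>X Y Z. eval3 \<Phi> (\<lambda>X' Y' Z'. \<epsilon> Z' *s h (X * X') (Y * Y') Z))"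
    proof -
      have "eval2 (\<Delta> Y') (\<lambda>Y1 Y2. eval3 \<Phi> (\<lambda>X'' Y'' Z''.
          \<epsilon> (Y2 * Z'') *s h (X' * X'') (Y1 * Y'') Z'))
        = eval3 \<Phi> (\<lambda>X'' Y'' Z''. \<epsilon> Z'' *s h (X' * X'') (Y' * Y'') Z')" for X' Y' Z'
        using eval_counit_right[of "\<lambda>Y1. eval3 \<Phi> (\<lambda>X'' Y'' Z''.
            \<epsilon> Z'' *s h (X' * X'') (Y1 * Y'') Z')" Y']
        by (simp add: counit_mult eval3_scale[symmetric] lin_intros lin_trilin[OF h])
      then show ?thesis by simp
    qed
    finally show ?thesis
      using eval_pentagon[OF f] unfolding 1 2
      by (simp add: counit_mult eval2_scale[symmetric] eval3_scale[symmetric] mult.assoc)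
  qed
  \<comment> \<open>Now \<open>e\<close> stands to the right of \<Phi>, so the test map multiplies
    by \<open>\<Phi>'\<close> on the left; the sums must be interchanged before the cancellation is
    visible.\<close>
  define h where "h = (\<lambda>a b c. eval3 \<Phi>' (\<lambda>X Y Z. \<epsilon> (Z * c) *s g (X * a) (Y * b)))"
  have tri: "trilin (\<lambda>a b c. \<epsilon> c *s g a b)"
    by (intro multilinI lin_bialgebra lin_bilin[OF g])
  have tri': "trilin (\<lambda>a b c. eval3 \<Phi> (\<lambda>X' Y' Z'. \<epsilon> c *s \<epsilon> Z' *s g (a * X') (b * Y')))"
    by (intro multilinI lin_bialgebra lin_bilin[OF g])
  have "trilin h"
    unfolding h_def by (intro multilinI lin_bialgebra lin_bilin[OF g])
  from *[OF this] have "eval3 \<Phi> h =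
    eval3 \<Phi>' (\<lambda>X Y Z. eval3 \<Phi> (\<lambda>X' Y' Z'. eval3 \<Phi> (\<lambda>X'' Y'' Z''.
      \<epsilon> (Z * Z') *s \<epsilon> Z'' *s g (X * X' * X'') (Y * Y' * Y''))))"
    unfolding h_def
    by (subst eval3_eval3_swap[of \<Phi>'], subst eval3_eval3_swap[of \<Phi>'])
      (simp add: counit_scale_simps eval3_scale[symmetric])
  moreover have "eval3 \<Phi> h = g 1 1"
    unfolding h_def using eval_assoc_inverse(2)[OF tri]
    by (subst eval3_eval3_swap) (simp add: counit_one)
  ultimately show ?thesis
    using eval_assoc_inverse(2)[OF tri'] by (simp add: counit_one)
qed

text \<open>Apply the counit to one factor of \<open>\<Phi>' \<cdot>\<^sub>3 \<Phi> = one3\<close>: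
  the contribution of \<Phi> is already known to be trivial.\<close>

lemma eval_counit_assoc_inverse:
  assumes g: "bilin g"
  shows "eval3 \<Phi>' (\<lambda>X Y Z. \<epsilon> X *s g Y Z) = g 1 1" (is ?left)
    and "eval3 \<Phi>' (\<lambda>X Y Z. \<epsilon> Y *s g X Z) = g 1 1" (is ?middle)
proof -
  have *: "trilin (\<lambda>a b c. \<epsilon> a *s g b c)" "trilin (\<lambda>a b c. \<epsilon> b *s g a c)"
    "bilin (\<lambda>b c. \<epsilon> r *s g (p * b) (q * c))" for p q r
    by (intro multilinI lin_bialgebra lin_bilin[OF g])+
  show ?left
    using eval_assoc_inverse(2)[OF *(1)] eval_counit_assoc_left[OF *(3)]
    by (simp add: counit_mult counit_one mult.commute)
  show ?middle
    using eval_assoc_inverse(2)[OF *(2)] eval_counit_assoc_middle[OF *(3)]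
    by (simp add: counit_mult counit_one mult.commute)
qed

end

section \<open>Bending invariant elements\<close>

context quasi_hopf_algebra
begin

lemma lin_antipode: "lin f \<Longrightarrow> lin (\<lambda>x. S (f x))"
  using antipode_linear by (simp add: Vector_Spaces.linear_iff lin_def)

lemmas lin_hopf = lin_bialgebra lin_antipode

text \<open>The linear map \<open>g\<close> stands for the surrounding expression, so that the
  antipode axioms apply in the middle of a product.\<close>

lemma eval_antipode_left: "lin g \<Longrightarrow> eval2 (\<Delta> a) (\<lambda>x y. g (S x * \<alpha> * y)) = \<epsilon> a *s g \<alpha>"
  and eval_antipode_right: "lin g \<Longrightarrow> eval2 (\<Delta> a) (\<lambda>x y. g (x * \<beta> * S y)) = \<epsilon> a *s g \<beta>"
  using lin_sum_list[of g "\<lambda>(x, y). S x * \<alpha> * y" "terms2 (\<Delta> a)"]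
    lin_sum_list[of g "\<lambda>(x, y). x * \<beta> * S y" "terms2 (\<Delta> a)"]
  by (simp_all add: antipode_left[unfolded split_def] antipode_right[unfolded split_def] eval_defs
      split_def lin_def)

lemma eval_antipode_assoc_inverse: "eval3 \<Phi>' (\<lambda>X Y Z. S X * \<alpha> * Y * \<beta> * S Z) = 1"
  using antipode_assoc_inverse by (simp add: eval_defs)

definition transfer :: "'a \<Rightarrow> 'a" where
  "transfer q = eval3 \<Phi> (\<lambda>X Y Z. S (S X) * q * S Y * \<alpha> * Z)"

text \<open>Evaluate quasi-coassociativity at the form that defines \<open>transfer\<close>. On one
  side the axiom for \<alpha> contracts the last two factors, on the other the invariance of
  \<open>q\<close> contracts the first two.\<close>

lemma transfer_intertwines:
  assumes q: "\<And>a g. lin g \<Longrightarrow> eval2 (\<Delta> a) (\<lambda>x y. g (S (S x) * q * S y)) = \<epsilon> a *s g q"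
  shows "S (S a) * transfer q = transfer q * a"
proof -
  have f: "trilin (\<lambda>a b c. S (S a) * q * S b * \<alpha> * c)"
    by (intro multilinI lin_hopf)
  have "eval2 (\<Delta> y) (\<lambda>y1 y2. eval3 \<Phi> (\<lambda>X Y Z. S (S (x * X)) * q * S (y1 * Y) * \<alpha> * (y2 * Z)))
    = \<epsilon> y *s (S (S x) * transfer q)" for x y
    using eval_antipode_left[of "\<lambda>m. eval3 \<Phi> (\<lambda>X Y Z. S (S (x * X)) * q * S Y * m * Z)" y]
    by (simp add: transfer_def lin_hopf antipode_mult mult.assoc eval_lin[OF lin_mult_right[OF
        lin_id]])
  moreover have "eval2 (\<Delta> a) (\<lambda>x y. \<epsilon> y *s (S (S x) * transfer q)) = S (S a) * transfer q"
    by (rule eval_counit_right) (intro lin_hopf)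
  moreover have "eval2 (\<Delta> a) (\<lambda>x y. eval2 (\<Delta> x) (\<lambda>x1 x2.
      S (S (X * x1)) * q * S (Y * x2) * \<alpha> * (Z * y))) = S (S X) * q * S Y * \<alpha> * Z * a" for X Y Z
  proof -
    have "eval2 (\<Delta> x) (\<lambda>x1 x2. S (S (X * x1)) * q * S (Y * x2) * \<alpha> * (Z * y)) =
        \<epsilon> x *s (S (S X) * q * S Y * \<alpha> * Z * y)" for x y
      using q[of "\<lambda>m. S (S X) * m * S Y * \<alpha> * Z * y" x]
      by (simp add: lin_hopf antipode_mult mult.assoc)
    then show ?thesis
      using eval_counit_left[of "\<lambda>y. S (S X) * q * S Y * \<alpha> * Z * y" a] by (simp add: lin_hopf)
  qed
  ultimately show ?thesis
    using eval_quasi_coassoc[OF f, of a]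
    by (simp add: transfer_def eval_lin[OF lin_mult_left[OF lin_id]])
qed

text \<open>Evaluate the pentagon, multiplied from the left by 1 \<otimes> \<open>\<Phi>'\<close>,
  at the form \<open>G\<close>. On each side every coproduct is contracted by the invariance of
  \<open>q\<close> or by an antipode axiom, which turns further associators into counit
  terms.\<close>

lemma transfer_coevaluation:
  assumes q: "\<And>a g. lin g \<Longrightarrow> eval2 (\<Delta> a) (\<lambda>x y. g (S (S x) * q * S y)) = \<epsilon> a *s g q"
  shows "transfer q * \<beta> = q"
proof -
  define G where "G a b c d = S (S a) * q * S b * \<alpha> * c * \<beta> * S d" for a b c d
  have G: "quadrilin G"
    unfolding G_def by (intro multilinI lin_hopf)
  have G': "quadrilin (\<lambda>a b c d. G a (x * b) (y * c) (z * d))" for x y z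
    by (intro multilinI lin_quadrilin[OF G] lin_hopf)
  \<comment> \<open>These are the two sides of the pentagon multiplied from the left by 1 \<otimes>
    a \<otimes> b \<otimes> c. Letting \<open>a\<close>, \<open>b\<close>, \<open>c\<close> run
    through \<open>\<Phi>'\<close> cancels the factor 1 \<otimes> \<Phi> in
    \<open>?R\<close>.\<close>
  let ?L = "\<lambda>a b c. eval3 \<Phi> (\<lambda>X Y Z. eval2 (\<Delta> Z) (\<lambda>Z1 Z2. eval3 \<Phi> (\<lambda>X' Y' Z'. eval2 (\<Delta> X') (\<lambda>X1 X2.
      G (X * X1) (a * (Y * X2)) (b * (Z1 * Y')) (c * (Z2 * Z'))))))"
  let ?R = "\<lambda>a b c. eval3 \<Phi> (\<lambda>X Y Z. eval3 \<Phi> (\<lambda>X' Y' Z'. eval2 (\<Delta> Y') (\<lambda>Y1 Y2.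
      eval3 \<Phi> (\<lambda>X'' Y'' Z''.
      G (X' * X'') (a * (X * Y1 * Y'')) (b * (Y * Y2 * Z'')) (c * (Z * Z'))))))"
  have "?L a b c = q * S a * \<alpha> * b * \<beta> * S c" for a b c
  proof -
    have "eval2 (\<Delta> X') (\<lambda>X1 X2. G (X * X1) (a * (Y * X2)) y z) =
        \<epsilon> X' *s G X (a * Y) y z" for X X' Y y z
      using q[of "\<lambda>m. S (S X) * m * S Y * S a * \<alpha> * y * \<beta> * S z" X']
      by (simp add: G_def lin_hopf antipode_mult mult.assoc)
    moreover have "eval3 \<Phi> (\<lambda>X' Y' Z'. \<epsilon> X' *s G X (a * Y) (b * (Z1 * Y')) (c * (Z2 * Z')))
        = G X (a * Y) (b * (Z1 * 1)) (c * (Z2 * 1))" for X Y Z1 Z2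
      by (intro eval_counit_assoc_left multilinI lin_quadrilin[OF G] lin_hopf)
    moreover have "eval2 (\<Delta> Z) (\<lambda>Z1 Z2. G X (a * Y) (b * Z1) (c * Z2)) =
        \<epsilon> Z *s G X (a * Y) b c" for X Y Z
      using eval_antipode_right[of "\<lambda>m. S (S X) * q * S (a * Y) * \<alpha> * b * m * S c" Z]
      by (simp add: G_def lin_hopf antipode_mult mult.assoc)
    moreover have "eval3 \<Phi> (\<lambda>X Y Z. \<epsilon> Z *s G X (a * Y) b c) = G 1 (a * 1) b c"
      by (intro eval_counit_assoc_right multilinI lin_quadrilin[OF G] lin_hopf)
    ultimately show ?thesis
      by (simp add: G_def antipode_one)
  qed
  \<comment> \<open>What is left of \<open>?L\<close> is \<open>q\<close> times the expression that
    sums to \<open>1\<close> over \<open>\<Phi>'\<close>.\<close>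
  then have "eval3 \<Phi>' ?L = q"
    using eval_lin(2)[OF lin_mult_right[OF lin_id], of q \<Phi>' "\<lambda>X Y Z. S X * \<alpha> * Y * \<beta> * S Z"]
    by (simp add: eval_antipode_assoc_inverse[unfolded mult.assoc] mult.assoc)
  moreover have "eval3 \<Phi>' ?R = transfer q * \<beta>"
  proof -
    have "trilin (\<lambda>a b c. eval3 \<Phi> (\<lambda>X' Y' Z'. eval2 (\<Delta> Y') (\<lambda>Y1 Y2. eval3 \<Phi> (\<lambda>X'' Y'' Z''.
      G (X' * X'') (a * Y1 * Y'') (b * Y2 * Z'') (c * Z')))))"
      by (intro multilinI lin_quadrilin[OF G] lin_hopf)
    note R = eval_assoc_inverse(2)[OF this]
    have "eval2 (\<Delta> Y) (\<lambda>Y1 Y2. eval3 \<Phi> (\<lambda>X' Y' Z'. G (X * X') (Y1 * Y') (Y2 * Z') Z)) =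
      \<epsilon> Y *s eval3 \<Phi> (\<lambda>X' Y' Z'. G (X * X') Y' Z' Z)" for X Y Z
      using eval_antipode_left[of "\<lambda>m. eval3 \<Phi> (\<lambda>X' Y' Z'.
          S (S (X * X')) * q * S Y' * m * Z' * \<beta> * S Z)" Y]
      by (simp add: G_def lin_hopf antipode_mult mult.assoc)
    then have "eval3 \<Phi>' ?R =
        eval3 \<Phi> (\<lambda>X Y Z. \<epsilon> Y *s eval3 \<Phi> (\<lambda>X' Y' Z'. G (X * X') Y' Z' Z))"
      using R by (simp add: mult.assoc)
    also have "eval3 \<Phi> (\<lambda>X Y Z. \<epsilon> Y *s eval3 \<Phi> (\<lambda>X' Y' Z'. G (X * X') Y' Z' Z)) =
      eval3 \<Phi> (\<lambda>X' Y' Z'. G (1 * X') Y' Z' 1)"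
      by (intro eval_counit_assoc_middle multilinI lin_quadrilin[OF G] lin_hopf)
    also have "\<dots> = transfer q * \<beta>"
      by (simp add: G_def transfer_def antipode_one eval_lin[OF lin_mult_left[OF lin_id]])
    finally show ?thesis .
  qed
  ultimately show ?thesis
    using eval_pentagon[OF G'] by simp
qed

end

section \<open>The Drinfel'd element\<close>

context quasitriangular_quasi_hopf_algebra
begin

section \<open>The axioms of the R-matrix tested on multilinear maps\<close>

lemma eval_R_comult:
  assumes "bilin f"
  shows "eval2 (\<Delta> a) (\<lambda>x y. eval2 R (\<lambda>s t. f (y * s) (x * t))) =
    eval2 R (\<lambda>s t. eval2 (\<Delta> a) (\<lambda>x y. f (s * x) (t * y)))"
proof -
  have "bilin (\<lambda>y x. eval2 R (\<lambda>s t. f (y * s) (x * t)))"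
    by (intro multilinI lin_intros lin_bilin[OF assms])
  from eval2_tensor[OF this] show ?thesis
    using arg_cong[where f="\<lambda>X. eval2 X f", OF R_comult[of a]]
    unfolding eval2_mult[OF assms] by (simp add: eval_defs split_def comp_def)
qed

lemma eval_hexagon_left:
  assumes "trilin f"
  shows "eval2 R (\<lambda>s t. eval2 (\<Delta> s) (\<lambda>s1 s2. f s1 s2 t)) =
    eval3 \<Phi> (\<lambda>Xi Yi Zi. eval3 \<Phi>' (\<lambda>Xj Yj Zj. eval3 \<Phi> (\<lambda>Xk Yk Zk. eval2 R (\<lambda>s t. eval2 R (\<lambda>s' t'.
      f (Yi * s * Xj * Xk) (Zi * Zj * s' * Yk) (Xi * t * Yj * t' * Zk))))))"
  using arg_cong[where f="\<lambda>X. eval3 X f", OF hexagon_left]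
  unfolding eval3_tensor[OF assms] by (simp add: eval_defs sum_list_comprehension)

lemma eval_hexagon_right:
  assumes "trilin f"
  shows "eval2 R (\<lambda>s t. eval2 (\<Delta> t) (\<lambda>t1 t2. f s t1 t2)) =
    eval3 \<Phi>' (\<lambda>Xi Yi Zi. eval3 \<Phi> (\<lambda>Xj Yj Zj. eval3 \<Phi>' (\<lambda>Xk Yk Zk. eval2 R (\<lambda>s t. eval2 R (\<lambda>s' t'.
      f (Zi * s * Yj * s' * Xk) (Xi * Xj * t' * Yk) (Yi * t * Zj * Zk))))))"
  using arg_cong[where f="\<lambda>X. eval3 X f", OF hexagon_right]
  unfolding eval3_tensor[OF assms] by (simp add: eval_defs sum_list_comprehension)

text \<open>
  Applying \<open>\<epsilon>\<close> to a hexagon gives \<open>R = (1 \<otimes> (\<epsilon> \<otimes> id) R) R\<close> and its mirror image; this is where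
  invertibility of \<open>R\<close> is used.
\<close>

lemma eval_counit_R:
  assumes g: "lin g"
  shows "eval2 R (\<lambda>s t. \<epsilon> s *s g t) = g 1" and "eval2 R (\<lambda>s t. \<epsilon> t *s g s) = g 1"
proof -
  obtain R' where R': "R \<cdot>\<^sub>2 R' = one2" "R' \<cdot>\<^sub>2 R = one2"
    using R_invertible by blast
  have inv: "eval2 R (\<lambda>s t. eval2 R' (\<lambda>s' t'. f (s * s') (t * t'))) = f 1 1"
    "eval2 R' (\<lambda>s t. eval2 R (\<lambda>s' t'. f (s * s') (t * t'))) = f 1 1" if "bilin f" for f
    unfolding eval2_mult[OF that, symmetric] R' eval2_tensor[OF that] by simp_all
  note lin_g = lin_bialgebra lin_comp[OF g]
  have left: "eval2 R h = eval2 R (\<lambda>s t. \<epsilon> s *s eval2 R (\<lambda>s' t'.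
      h s' (t * t')))" if h: "bilin h" for h
  proof -
    note lin_h = lin_bialgebra lin_bilin[OF h]
    have f: "trilin (\<lambda>a b c. \<epsilon> a *s h b c)"
      by (intro multilinI lin_h)
    have "eval2 R (\<lambda>s t. eval2 (\<Delta> s) (\<lambda>s1 s2. \<epsilon> s1 *s h s2 t)) = eval2 R h"
      by (simp add: eval_counit_left[of "\<lambda>s. h s t" for t] lin_h)
    moreover have "eval3 \<Phi> (\<lambda>Xi Yi Zi. eval3 \<Phi>' (\<lambda>Xj Yj Zj. eval3 \<Phi> (\<lambda>Xk Yk Zk.
        eval2 R (\<lambda>s t. eval2 R (\<lambda>s' t'. \<epsilon> (Yi * s * Xj * Xk) *s
          h (Zi * Zj * s' * Yk) (Xi * t * Yj * t' * Zk)))))) =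
      eval3 \<Phi> (\<lambda>Xi Yi Zi. \<epsilon> Yi *s eval3 \<Phi>' (\<lambda>Xj Yj Zj. \<epsilon> Xj *s eval3 \<Phi> (\<lambda>Xk Yk Zk.
        \<epsilon> Xk *s eval2 R (\<lambda>s t. eval2 R (\<lambda>s' t'. \<epsilon> s *s
          h (Zi * Zj * s' * Yk) (Xi * t * Yj * t' * Zk))))))"
      by (simp add: counit_scale_simps eval2_scale[symmetric] eval3_scale[symmetric])
    \<comment> \<open>The counit now meets one factor of each associator, so all three disappear and
      two copies of \<open>R\<close> remain.\<close>
    moreover have "\<dots> = eval2 R (\<lambda>s t. eval2 R (\<lambda>s' t'. \<epsilon> s *s h s' (t * t')))"
      by (subst eval_counit_assoc_middle, intro multilinI lin_h,
          subst eval_counit_assoc_inverse(1), intro multilinI lin_h,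
          subst eval_counit_assoc_left, intro multilinI lin_h) simp
    ultimately show ?thesis
      using eval_hexagon_left[OF f] by (simp add: eval2_scale)
  qed
  have right: "eval2 R h = eval2 R (\<lambda>s t. eval2 R (\<lambda>s' t'.
      \<epsilon> t' *s h (s * s') t))" if h: "bilin h" for h
  proof -
    note lin_h = lin_bialgebra lin_bilin[OF h]
    have f: "trilin (\<lambda>a b c. \<epsilon> b *s h a c)"
      by (intro multilinI lin_h)
    have "eval2 R (\<lambda>s t. eval2 (\<Delta> t) (\<lambda>t1 t2. \<epsilon> t1 *s h s t2)) = eval2 R h"
      by (simp add: eval_counit_left[of "\<lambda>t. h s t" for s] lin_h)
    moreover have "eval3 \<Phi>' (\<lambda>Xi Yi Zi. eval3 \<Phi> (\<lambda>Xj Yj Zj. eval3 \<Phi>' (\<lambda>Xk Yk Zk.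
        eval2 R (\<lambda>s t. eval2 R (\<lambda>s' t'. \<epsilon> (Xi * Xj * t' * Yk) *s
          h (Zi * s * Yj * s' * Xk) (Yi * t * Zj * Zk)))))) =
      eval3 \<Phi>' (\<lambda>Xi Yi Zi. \<epsilon> Xi *s eval3 \<Phi> (\<lambda>Xj Yj Zj. \<epsilon> Xj *s eval3 \<Phi>' (\<lambda>Xk Yk Zk.
        \<epsilon> Yk *s eval2 R (\<lambda>s t. eval2 R (\<lambda>s' t'. \<epsilon> t' *s
          h (Zi * s * Yj * s' * Xk) (Yi * t * Zj * Zk))))))"
      by (simp add: counit_scale_simps eval2_scale[symmetric] eval3_scale[symmetric])
    moreover have "\<dots> = eval2 R (\<lambda>s t. eval2 R (\<lambda>s' t'. \<epsilon> t' *s h (s * s') t))"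
      by (subst eval_counit_assoc_inverse(1), intro multilinI lin_h,
          subst eval_counit_assoc_left, intro multilinI lin_h,
          subst eval_counit_assoc_inverse(2), intro multilinI lin_h) simp
    ultimately show ?thesis
      using eval_hexagon_right[OF f] by simp
  qed
  \<comment> \<open>The last two maps multiply by \<open>R'\<close> on the right and on the left:
    \<open>left\<close> has its extra factor to the left of \<open>R\<close>, \<open>right\<close>
    has it to the right.\<close>
  have f: "bilin (\<lambda>a b. \<epsilon> a *s g b)" "bilin (\<lambda>a b. \<epsilon> b *s g a)" "bilin (\<lambda>a b. \<epsilon> a *s g (t * b))"
    "bilin (\<lambda>a b. eval2 R (\<lambda>s' t'. \<epsilon> b *s \<epsilon> t' *s g (a * s')))"
    "bilin (\<lambda>a b. eval2 R' (\<lambda>s t. \<epsilon> (a * s) *s g (b * t)))"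
    "bilin (\<lambda>a b. eval2 R' (\<lambda>s t. \<epsilon> (t * b) *s g (s * a)))" for t
    by (intro multilinI lin_g)+
  show "eval2 R (\<lambda>s t. \<epsilon> s *s g t) = g 1"
    using left[OF f(5)] inv(1)[OF f(1)] inv(1)[OF f(3)] by (simp add: mult.assoc counit_one)
  have "eval2 R (\<lambda>s t. eval2 R' (\<lambda>s' t'. \<epsilon> (t' * t) *s g (s' * s))) = g 1"
    using inv(2)[OF f(2)] by (subst eval2_eval2_swap) (simp add: counit_one)
  moreover have "eval2 R (\<lambda>s t. eval2 R (\<lambda>s' t'. \<epsilon> t' *s eval2 R' (\<lambda>s'' t''.
      \<epsilon> (t'' * t) *s g (s'' * (s * s')))))
      = eval2 R' (\<lambda>s'' t''. eval2 R (\<lambda>s t. eval2 R (\<lambda>s' t'.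
          \<epsilon> (t'' * t) *s \<epsilon> t' *s g (s'' * s * s'))))"
    by (subst eval2_eval2_swap[where X=R' and X'=R], subst eval2_eval2_swap[where X=R' and X'=R])
      (simp add: eval2_scale[symmetric] mult.assoc mult.commute)
  ultimately show "eval2 R (\<lambda>s t. \<epsilon> t *s g s) = g 1"
    using right[OF f(6)] inv(2)[OF f(4)] by (simp add: counit_one)
qed

text \<open>Pulling the outer factors inside \<open>S\<close> reverses them, so the opposite
  coproduct stands to the left of \<open>R\<close>. Moved across \<open>R\<close> it becomes the
  coproduct, which the axiom for \<beta> contracts.\<close>

lemma braided_coevaluation:
  defines "q \<equiv> S (eval2 R (\<lambda>s t. s * \<beta> * S t))"
  assumes g: "lin g"
  shows "eval2 (\<Delta> a) (\<lambda>x y. g (S (S x) * q * S y)) = \<epsilon> a *s g q"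
proof -
  note lin_g = lin_hopf lin_comp[OF g]
  have f: "bilin (\<lambda>s t. g (S (s * \<beta> * S t)))"
    by (intro multilinI lin_g)
  have "g (S (S x) * q * S y) = eval2 R (\<lambda>s t. g (S (y * s * \<beta> * S (x * t))))" for x y
    using eval_lin(1)[of "\<lambda>m. g (S (S x) * S m * S y)"]
    by (simp add: q_def lin_g antipode_mult mult.assoc)
  moreover have "eval2 (\<Delta> a) (\<lambda>x y. g (S (s * x * \<beta> * S (t * y)))) =
      \<epsilon> a *s g (S (s * \<beta> * S t))" for s t
    using eval_antipode_right[of "\<lambda>m. g (S (s * m * S t))" a]
    by (simp add: lin_g antipode_mult mult.assoc)
  moreover have "eval2 R (\<lambda>s t. g (S (s * \<beta> * S t))) = g q"
    using eval_lin(1)[of "\<lambda>m. g (S m)"] by (simp add: q_def lin_g)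
  ultimately show ?thesis
    using eval_R_comult[OF f, of a] by (simp add: eval2_scale)
qed

lemma drinfeld_element_eq_transfer:
  "drinfeld_element = transfer (S (eval2 R (\<lambda>s t. s * \<beta> * S t)))"
proof -
  \<comment> \<open>The arguments are the entries on strands 1, 2, 3:
    \<open>S (b * \<beta> * S c)\<close> creates strands 2 and 3, and \<alpha> closes strand 2
    against strand 1.\<close>
  define F where "F a b c = S (S c) * S \<beta> * S b * \<alpha> * a" for a b c
  have F: "trilin F"
    unfolding F_def by (intro multilinI lin_hopf)
  note lin_F = lin_hopf lin_trilin[OF F]
  \<comment> \<open>A further copy of \<open>R\<close> is inserted with its second factor doubled on
    strands 2 and 3. There \<beta> reduces it to its counit, so nothing changes, and the second
    hexagon expands it.\<close>
  have expand: "F Z (Y * s) (X * t) =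
    eval3 \<Phi>' (\<lambda>Xi Yi Zi. eval3 \<Phi> (\<lambda>Xj Yj Zj. eval3 \<Phi>' (\<lambda>Xk Yk Zk. eval2 R (\<lambda>s' t'.
        eval2 R (\<lambda>s'' t''.
      F (Z * (Zi * s' * Yj * s'' * Xk)) (Y * s * (Xi * Xj * t'' * Yk))
        (X * t * (Yi * t' * Zj * Zk)))))))"
    for X Y Z s t
  proof -
    have "eval2 (\<Delta> t') (\<lambda>t1 t2. F (Z * s') (Y * s * t1) (X * t * t2)) =
        \<epsilon> t' *s F (Z * s') (Y * s) (X * t)"
      for s' t'
      using eval_antipode_right[of "\<lambda>m. S (S (X * t)) * S m * S (Y * s) * \<alpha> * (Z * s')" t']
      by (simp add: F_def lin_hopf antipode_mult mult.assoc)
    then have "F Z (Y * s) (X * t) =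
        eval2 R (\<lambda>s' t'. eval2 (\<Delta> t') (\<lambda>t1 t2. F (Z * s') (Y * s * t1) (X * t * t2)))"
      using eval_counit_R(2)[of "\<lambda>s'. F (Z * s') (Y * s) (X * t)"] by (simp add: lin_F)
    also have "\<dots> =
        eval3 \<Phi>' (\<lambda>Xi Yi Zi. eval3 \<Phi> (\<lambda>Xj Yj Zj. eval3 \<Phi>' (\<lambda>Xk Yk Zk. eval2 R (\<lambda>s' t'.
            eval2 R (\<lambda>s'' t''.
          F (Z * (Zi * s' * Yj * s'' * Xk)) (Y * s * (Xi * Xj * t'' * Yk))
            (X * t * (Yi * t' * Zj * Zk)))))))"
      by (intro eval_hexagon_right multilinI lin_F)
    finally show ?thesis .
  qed
  \<comment> \<open>The coproduct on strands 2 and 1 meets \<alpha>, so the copy of \<open>R\<close>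
    reassembled by the first hexagon drops to its counit.\<close>
  have contract: "eval2 (\<Delta> s) (\<lambda>s1 s2. eval2 R (\<lambda>s'' t''. eval3 \<Phi>' (\<lambda>X Y Z.
      F (s2 * s'' * X) (s1 * t'' * Y) (t * Z)))) =
    \<epsilon> s *s eval2 R (\<lambda>s'' t''. eval3 \<Phi>' (\<lambda>X Y Z. F (s'' * X) (t'' * Y) (t * Z)))" for s t
    using eval_antipode_left[of "\<lambda>m. eval2 R (\<lambda>s'' t''. eval3 \<Phi>' (\<lambda>X Y Z.
      S (S (t * Z)) * S \<beta> * S (t'' * Y) * m * (s'' * X)))" s]
    by (simp add: F_def lin_hopf antipode_mult mult.assoc)
  have "transfer (S (eval2 R (\<lambda>s t. s * \<beta> * S t))) =
      eval3 \<Phi> (\<lambda>X Y Z. eval2 R (\<lambda>s t. F Z (Y * s) (X * t)))"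
    using eval_lin(1)[of "\<lambda>m. S (S X) * S m * S Y * \<alpha> * Z" R "\<lambda>s t. s * \<beta> * S t" for X Y Z]
    by (simp add: transfer_def F_def lin_hopf antipode_mult mult.assoc)
  also have "\<dots> = eval3 \<Phi> (\<lambda>X Y Z. eval2 R (\<lambda>s t.
      eval3 \<Phi>' (\<lambda>Xi Yi Zi. eval3 \<Phi> (\<lambda>Xj Yj Zj. eval3 \<Phi>' (\<lambda>Xk Yk Zk. eval2 R (\<lambda>s' t'.
          eval2 R (\<lambda>s'' t''.
      F (Z * (Zi * s' * Yj * s'' * Xk)) (Y * s * (Xi * Xj * t'' * Yk))
        (X * t * (Yi * t' * Zj * Zk)))))))))"
    by (intro arg_cong[where f="eval3 \<Phi>"] arg_cong[where f="eval2 R"] ext expand)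
  \<comment> \<open>Only the sums are reordered and the products rebracketed. The first five sums
    are now the expanded side of the first hexagon with strands 1 and 2 exchanged; one
    \<open>R\<close> and one \<open>\<Phi>'\<close> are left over.\<close>
  also have "\<dots> =
    eval3 \<Phi> (\<lambda>Xi Yi Zi. eval3 \<Phi>' (\<lambda>Xj Yj Zj. eval3 \<Phi> (\<lambda>Xk Yk Zk. eval2 R (\<lambda>s t. eval2 R (\<lambda>s' t'.
      eval2 R (\<lambda>s'' t''. eval3 \<Phi>' (\<lambda>X Y Z. F (Zi * Zj * s' * Yk * s'' * X)
        (Yi * s * Xj * Xk * t'' * Y) (Xi * t * Yj * t' * Zk * Z))))))))"
    by (simp only: eval2_eval3_swap mult.assoc)
  also have "\<dots> = eval2 R (\<lambda>s t. eval2 (\<Delta> s) (\<lambda>s1 s2.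
      eval2 R (\<lambda>s'' t''. eval3 \<Phi>' (\<lambda>X Y Z. F (s2 * s'' * X) (s1 * t'' * Y) (t * Z)))))"
    by (rule eval_hexagon_left[symmetric]) (intro multilinI lin_F)
  also have "\<dots> =
      eval2 R (\<lambda>s t. \<epsilon> s *s eval2 R (\<lambda>s'' t''. eval3 \<Phi>' (\<lambda>X Y Z. F (s'' * X) (t'' * Y) (t * Z))))"
    by (simp only: contract)
  also have "\<dots> = eval2 R (\<lambda>s t. eval3 \<Phi>' (\<lambda>X Y Z. F (s * X) (t * Y) (1 * Z)))"
    by (intro eval_counit_R(1) lin_F)
  also have "\<dots> = drinfeld_element"
    unfolding eval2_eval3_swap
    by (simp add: drinfeld_element_def eval_defs F_def antipode_mult mult.assoc)
  finally show ?thesis ..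
qed

lemma drinfeld_element_eq_antipode_opcop: "drinfeld_element = S opcop_drinfeld_element"
proof -
  define q where "q = S (eval2 R (\<lambda>s t. s * \<beta> * S t))"
  note q = braided_coevaluation[folded q_def]
  let ?u = "transfer q"
  \<comment> \<open>Write \<open>q\<close> as \<open>?u * \<beta>\<close>, then move the double
    antipode across \<open>?u\<close>.\<close>
  have zigzag: "S (S (S X * \<alpha> * Y)) * q * S Z = ?u * (S X * \<alpha> * Y * \<beta> * S Z)" for X Y Z
  proof -
    have "S (S (S X * \<alpha> * Y)) * q * S Z = S (S (S X * \<alpha> * Y)) * ?u * \<beta> * S Z"
      by (simp add: transfer_coevaluation[OF q] mult.assoc)
    also have "\<dots> = ?u * (S X * \<alpha> * Y) * \<beta> * S Z"
      by (simp only: transfer_intertwines[OF q])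
    finally show ?thesis
      by (simp add: mult.assoc)
  qed
  have "S opcop_drinfeld_element = eval3 \<Phi>' (\<lambda>X Y Z. S (S (S X * \<alpha> * Y)) * q * S Z)"
  proof -
    \<comment> \<open>Collecting the sum over \<open>R\<close> in the middle exposes the element
      whose antipode is \<open>q\<close>.\<close>
    have "opcop_drinfeld_element = eval3 \<Phi>' (\<lambda>X Y Z. Z * eval2 R (\<lambda>s t.
        s * \<beta> * S t) * S (S X * \<alpha> * Y))"
      using eval_lin(1)[of "\<lambda>m. Z * m * S (S X * \<alpha> * Y)" R "\<lambda>s t. s * \<beta> * S t" for X Y Z]
      by (simp add: lin_hopf opcop_drinfeld_element_def eval_defs mult.assoc)
    then show ?thesis
      by (simp add: eval_lin[OF lin_antipode[OF lin_id]] q_def antipode_mult mult.assoc)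
  qed
  also have "\<dots> = eval3 \<Phi>' (\<lambda>X Y Z. ?u * (S X * \<alpha> * Y * \<beta> * S Z))"
    by (simp only: zigzag)
  also have "\<dots> = ?u"
    using eval_lin(2)[OF lin_mult_right[OF lin_id], of ?u \<Phi>' "\<lambda>X Y Z. S X * \<alpha> * Y * \<beta> * S Z"]
    by (simp add: eval_antipode_assoc_inverse)
  finally show ?thesis
    by (simp add: drinfeld_element_eq_transfer q_def)
qed

end

theorem proposition2p4:
  fixes scale :: "'k::field \<Rightarrow> 'a::ring_1 \<Rightarrow> 'a"
    and \<Delta> :: "'a \<Rightarrow> ('a \<times> 'a \<Rightarrow>\<^sub>0 'k) set"
    and \<epsilon> :: "'a \<Rightarrow> 'k"
    and \<Phi> \<Phi>' :: "('a \<times> 'a \<times> 'a \<Rightarrow>\<^sub>0 'k) set"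
    and S :: "'a \<Rightarrow> 'a"
    and \<alpha> \<beta> :: 'a
    and R :: "('a \<times> 'a \<Rightarrow>\<^sub>0 'k) set"
  assumes "quasitriangular_quasi_hopf_algebra scale \<Delta> \<epsilon> \<Phi> \<Phi>' S \<alpha> \<beta> R"
  shows "quasitriangular_quasi_hopf_algebra.drinfeld_element scale \<Phi>' S \<alpha> \<beta> R =
         S (quasitriangular_quasi_hopf_algebra.opcop_drinfeld_element scale \<Phi>' S \<alpha> \<beta> R)"
proof -
  interpret quasitriangular_quasi_hopf_algebra scale \<Delta> \<epsilon> \<Phi> \<Phi>' S \<alpha> \<beta> R
    by (rule assms)
  show ?thesis
    by (rule drinfeld_element_eq_antipode_opcop)
qed

end
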